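(* Let $\textsf{Th}^t_k : \mathbb{Z}_2^k \to \{0,1\}$ be a threshold predicate (so $\textsf{Th}^t_k(\mathbf{b}) = 1$ iff $\|\mathbf{b}\|_0 \geq t$, and $S = \{t,\ldots,k\}$), and let $p^* \in [0,1]$ be such that the max-min method applies, i.e., \[ \alpha(\textsf{Th}^t_k) = \inf_{\mathcal{D}_N \in \Delta_k} \left(\frac{\lambda_S(\mathcal{D}_N,p^* )}{\gamma_{S,k}(\mu(\mathcal{D}_N))}\right). \] Then the following algorithm, on input an instance $\Psi$ of $\mathsf{Max}\text{-}\mathsf{B}\text{-}\mathsf{CSP}[\textsf{Th}^t_k]$, outputs an assignment with expected value at least $\alpha(\textsf{Th}^t_k) \cdot \textsf{val}_\Psi$: Assign every variable $x_i$ to $1$ if $\textsf{bias}_\Psi(i) \geq 0$, and $0$ otherwise, and then flip each variable's assignment independently with probability $p^*$.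
   Context: For a predicate $f:\mathbb{Z}_2^k\to\{0,1\}$, an instance $\Psi$ of $\mathsf{Max}\text{-}\mathsf{B}\text{-}\mathsf{CSP}[f]$ on $n$ variables consists of weighted constraints $(\mathbf{b}(\ell),\mathbf{j}(\ell),w(\ell))_{\ell\in[m]}$, with $\mathbf{b}(\ell)\in\mathbb{Z}_2^k$ a negation pattern, $\mathbf{j}(\ell)\in[n]^k$ distinct indices, $w(\ell)\ge 0$; an assignment $\mathbf{x}\in\mathbb{Z}_2^n$ satisfies a constraint iff $f(\mathbf{b}(\ell)+\mathbf{x}|_{\mathbf{j}(\ell)})=1$; $\textsf{val}_\Psi(\mathbf{x})$ is the fraction of total weight $W_\Psi$ satisfied and $\textsf{val}_\Psi=\max_\mathbf{x}\textsf{val}_\Psi(\mathbf{x})$. The bias of variable $i$ is $\textsf{bias}_\Psi(i) = \sum_{\ell\in[m],\,t'\in[k]:\, j(\ell)_{t'} = i} (-1)^{b(\ell)_{t'}} w(\ell)$. $\Delta_k$ is the set of symmetric distributions on $\mathbb{Z}_2^k$ (strings of equal Hamming weight equiprobable); $\mathcal{D}\langle i\rangle$ is the total mass on Hamming weight $i$. For symmetric $\mathcal{D}$, $\mu(\mathcal{D}) = \mathbb{E}_{\mathbf{a}\sim\mathcal{D}}[(-1)^{a_1+1}]$. For $\mathcal{D}\in\Delta(\mathbb{Z}_2^k)$, the canonical instance $\Psi^{\mathcal{D}}$ on $k$ variables puts weight $\mathcal{D}(\mathbf{b})$ on constraint $((1,\ldots,k),\mathbf{b})$; $\lambda_S(\mathcal{D},p)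 = \mathbb{E}_{\mathbf{a}\sim\mathcal{B}_p^k}[\textsf{val}_{\Psi^{\mathcal{D}}}(\mathbf{a})]$ for the predicate $f_{S,k}(\mathbf{b})=\mathbf{1}_{\|\mathbf{b}\|_0\in S}$ (here $\mathcal{B}_p$ is Bernoulli, $0$ w.p. $p$ and $1$ w.p. $1-p$), $\gamma_S(\mathcal{D}) = \lambda_S(\mathcal{D},1)$, $\beta_S(\mathcal{D}) = \sup_{p\in[0,1]}\lambda_S(\mathcal{D},p)$, and $\gamma_{S,k}(\mu) = \sup_{\mathcal{D}_Y\in\Delta_k:\,\mu(\mathcal{D}_Y)=\mu}\gamma_S(\mathcal{D}_Y)$. The $\sqrt n$-space sketching approximability threshold is $\alpha(f_{S,k}) = \inf_{\mathcal{D}_N,\mathcal{D}_Y\in\Delta_k:\,\mu(\mathcal{D}_N)=\mu(\mathcal{D}_Y)} \beta_S(\mathcal{D}_N)/\gamma_S(\mathcal{D}_Y)$.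
   Formalization: Each variable's assignment is flipped with probability 1 − p* (kept with probability p* ), matching B_p being 0 with probability p; flipping with probability p* fails for k = t = 2, where α = 4/9, p* = 2/3, and one constraint x1 AND x2 gives only 1/9. *)

theory Defs
  imports "HOL-Probability.Probability" "HOL-Library.Z2" "HOL-Library.Multiset"
begin

text \<open>
  A vector of \<open>\<int>\<^sub>2\<^sup>k\<close> is a function \<^typ>\<open>nat \<Rightarrow> bit\<close> on the coordinates \<open>1, \<dots>, k\<close>, extended by
  \<open>0\<close> outside, so that equality of functions is equality of vectors. This is also the support of
  \<^const>\<open>Pi_pmf\<close> over \<open>{1..k}\<close> with default value \<open>0\<close>.
\<close>

definition cube :: "nat \<Rightarrow> (nat \<Rightarrow> bit) set" where
  "cube k = {b. \<forall>i. i \<notin> {1..k} \<longrightarrow> b i = 0}"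

definition weight :: "nat \<Rightarrow> (nat \<Rightarrow> bit) \<Rightarrow> nat" where
  "weight k b = card {i \<in> {1..k}. b i = 1}"

definition symm_pred :: "nat \<Rightarrow> nat set \<Rightarrow> (nat \<Rightarrow> bit) \<Rightarrow> bool" where
  "symm_pred k S b \<longleftrightarrow> weight k b \<in> S"

definition threshold :: "nat \<Rightarrow> nat \<Rightarrow> (nat \<Rightarrow> bit) \<Rightarrow> bool" where
  "threshold t k b \<longleftrightarrow> weight k b \<ge> t"

text \<open>\<open>(-1)\<^sup>b\<close> for \<open>b \<in> \<int>\<^sub>2\<close>.\<close>

definition sign_bit :: "bit \<Rightarrow> real" where
  "sign_bit b = (if b = 0 then 1 else -1)"


subsection \<open>Instances\<close>

record bconstraint =
  neg :: "nat \<Rightarrow> bit"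
  idx :: "nat \<Rightarrow> nat"
  wgt :: real

text \<open>
  The order of the constraints plays no role, and repetitions are allowed: an instance is a
  multiset of weighted constraints.
\<close>

type_synonym bcsp = "bconstraint multiset"

definition bcsp_instance :: "nat \<Rightarrow> nat \<Rightarrow> bcsp \<Rightarrow> bool" where
  "bcsp_instance n k \<Psi> \<longleftrightarrow> (\<forall>C \<in># \<Psi>.
     neg C \<in> cube k \<and> inj_on (idx C) {1..k} \<and> idx C ` {1..k} \<subseteq> {1..n} \<and> 0 \<le> wgt C)"

definition satisfies ::
  "nat \<Rightarrow> ((nat \<Rightarrow> bit) \<Rightarrow> bool) \<Rightarrow> (nat \<Rightarrow> bit) \<Rightarrow> bconstraint \<Rightarrow> bool" where
  "satisfies k f x C \<longleftrightarrow> f (\<lambda>t. if t \<in> {1..k} then neg C t + x (idx C t) else 0)"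

text \<open>The value is \<open>0\<close> if the total weight vanishes (division by zero).\<close>

definition csp_val ::
  "nat \<Rightarrow> ((nat \<Rightarrow> bit) \<Rightarrow> bool) \<Rightarrow> bcsp \<Rightarrow> (nat \<Rightarrow> bit) \<Rightarrow> real" where
  "csp_val k f \<Psi> x =
     (\<Sum>C\<in>#\<Psi>. wgt C * of_bool (satisfies k f x C)) / (\<Sum>C\<in>#\<Psi>. wgt C)"

definition csp_opt :: "nat \<Rightarrow> nat \<Rightarrow> ((nat \<Rightarrow> bit) \<Rightarrow> bool) \<Rightarrow> bcsp \<Rightarrow> real" where
  "csp_opt n k f \<Psi> = Max (csp_val k f \<Psi> ` cube n)"

definition bias :: "nat \<Rightarrow> bcsp \<Rightarrow> nat \<Rightarrow> real" where
  "bias k \<Psi> i = (\<Sum>C\<in>#\<Psi>. \<Sum>t | t \<in> {1..k} \<and> idx C t = i. sign_bit (neg C t) * wgt C)"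


subsection \<open>Symmetric distributions and the approximability threshold\<close>

definition symm_dists :: "nat \<Rightarrow> (nat \<Rightarrow> bit) pmf set" where
  "symm_dists k = {D. set_pmf D \<subseteq> cube k \<and>
     (\<forall>a\<in>cube k. \<forall>b\<in>cube k. weight k a = weight k b \<longrightarrow> pmf D a = pmf D b)}"

definition mu :: "(nat \<Rightarrow> bit) pmf \<Rightarrow> real" where
  "mu D = measure_pmf.expectation D (\<lambda>a. sign_bit (a 1 + 1))"

text \<open>\<open>\<B>\<^sub>p\<close>: the value \<open>0\<close> has probability \<open>p\<close> and the value \<open>1\<close> has probability \<open>1 - p\<close>.\<close>

definition bern :: "real \<Rightarrow> bit pmf" where
  "bern p = map_pmf (\<lambda>z. if z then 0 else 1) (bernoulli_pmf p)"

definition bern_power :: "nat \<Rightarrow> real \<Rightarrow> (nat \<Rightarrow> bit) pmf" where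
  "bern_power k p = Pi_pmf {1..k} 0 (\<lambda>_. bern p)"

definition canonical :: "nat \<Rightarrow> (nat \<Rightarrow> bit) pmf \<Rightarrow> bcsp" where
  "canonical k D = {# \<lparr>neg = b, idx = (\<lambda>t. t), wgt = pmf D b\<rparr>. b \<in># mset_set (cube k) #}"

definition lam :: "nat \<Rightarrow> nat set \<Rightarrow> (nat \<Rightarrow> bit) pmf \<Rightarrow> real \<Rightarrow> real" where
  "lam k S D p =
     measure_pmf.expectation (bern_power k p) (csp_val k (symm_pred k S) (canonical k D))"

definition gam :: "nat \<Rightarrow> nat set \<Rightarrow> (nat \<Rightarrow> bit) pmf \<Rightarrow> real" where
  "gam k S D = lam k S D 1"

definition bet :: "nat \<Rightarrow> nat set \<Rightarrow> (nat \<Rightarrow> bit) pmf \<Rightarrow> real" where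
  "bet k S D = (SUP p\<in>{0..1}. lam k S D p)"

definition gam_mu :: "nat \<Rightarrow> nat set \<Rightarrow> real \<Rightarrow> real" where
  "gam_mu k S m = (SUP D \<in> {D \<in> symm_dists k. mu D = m}. gam k S D)"

text \<open>
  In both infima below the denominators are nonnegative. A ratio with denominator \<open>0\<close> is understood
  as \<open>\<infinity>\<close> and so does not contribute; since division by zero in HOL yields \<open>0\<close> instead, these
  ratios are excluded explicitly.
\<close>

definition alpha :: "nat \<Rightarrow> nat set \<Rightarrow> real" where
  "alpha k S = Inf {bet k S DN / gam k S DY | DN DY.
     DN \<in> symm_dists k \<and> DY \<in> symm_dists k \<and> mu DN = mu DY \<and> gam k S DY > 0}"

definition max_min_value :: "nat \<Rightarrow> nat set \<Rightarrow> real \<Rightarrow> real" where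
  "max_min_value k S p = Inf {lam k S DN p / gam_mu k S (mu DN) | DN.
     DN \<in> symm_dists k \<and> gam_mu k S (mu DN) > 0}"


subsection \<open>The biased rounding algorithm\<close>

definition greedy :: "nat \<Rightarrow> nat \<Rightarrow> bcsp \<Rightarrow> nat \<Rightarrow> bit" where
  "greedy n k \<Psi> i = (if i \<in> {1..n} \<and> bias k \<Psi> i \<ge> 0 then 1 else 0)"

text \<open>
  The output distribution of the algorithm: the noise vector \<open>a\<close>, drawn from \<open>\<B>\<^sub>p\<^sup>n\<close>, is added to
  the greedy assignment. As \<open>\<B>\<^sub>p\<close> is \<open>0\<close> with probability \<open>p\<close>, every variable independently
  \<^emph>\<open>keeps\<close> its greedy value with probability \<open>p\<close> and is flipped with probability \<open>1 - p\<close>. This is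
  the noise in \<^const>\<open>lam\<close>, and it is the only reading for which the guarantee can hold: for
  \<open>k = t = 2\<close> one has \<open>\<alpha> = 4/9\<close> and \<open>p\<^sup>* = 2/3\<close>, and on a single unnegated constraint flipping with
  probability \<open>2/3\<close> achieves only \<open>1/9\<close>, whereas flipping with probability \<open>1/3\<close> achieves \<open>4/9\<close>.
\<close>

definition rounding :: "nat \<Rightarrow> nat \<Rightarrow> bcsp \<Rightarrow> real \<Rightarrow> (nat \<Rightarrow> bit) pmf" where
  "rounding n k \<Psi> p = map_pmf (\<lambda>a i. greedy n k \<Psi> i + a i) (bern_power n p)"

end

theory Submission
  imports Defs
begin

text \<open>
  An assignment \<open>x\<close> turns the weighted constraints into a distribution of patterns \<open>b + x|\<^sub>j\<close> on
  the cube; let \<open>D(x)\<close> be its symmetrization over Hamming weight levels. Since the noise and the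
  predicate are symmetric, \<open>x\<close> has value \<open>\<gamma>(D(x))\<close>, and its noisy version has expected value
  \<open>\<lambda>(D(x), p)\<close>. Moreover \<open>\<mu>(D(x))\<close> is proportional to \<open>-\<Sum>\<^sub>i bias(i) (-1)\<^bsup>x i\<^esup>\<close>, which the greedy
  assignment \<open>g\<close> maximizes. For a threshold predicate \<open>\<gamma>\<^sub>S\<^sub>,\<^sub>k\<close> is monotone in \<open>\<mu>\<close>, because mixing a
  distribution with the point mass at the all-ones vector raises \<open>\<mu>\<close> and does not lower \<open>\<gamma>\<close>. Hence
  \<open>\<gamma>\<^sub>S\<^sub>,\<^sub>k(\<mu>(D(g)))\<close> is at least the optimum, and the max-min hypothesis applied to \<open>D(g)\<close> gives the bound.
\<close>

section \<open>Cube, Hamming weight and coordinate permutations\<close>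

lemma finite_cube [simp]: "finite (cube k)"
proof -
  have "(UNIV :: bit set) = {0, 1}" by (auto simp: bit_not_zero_iff)
  then have "finite (UNIV :: bit set)" by (metis finite.emptyI finite_insert)
  then have "finite (PiE_dflt {1..k} (0::bit) (\<lambda>_. UNIV))"
    by (intro finite_PiE_dflt) auto
  then show ?thesis by (rule rev_finite_subset) (auto simp: cube_def PiE_dflt_def)
qed

lemma weight_le: "weight k b \<le> k"
  unfolding weight_def by (rule order.trans[OF card_mono[of "{1..k}"]]) auto

lemma threshold_eq_symm_pred: "threshold t k = symm_pred k {t..k}"
  by (auto simp: threshold_def symm_pred_def weight_le fun_eq_iff)

lemma weight_reindex:
  assumes "bij_betw h {1..k} {1..k}"
  shows "weight k (b \<circ> h) = weight k b"
proof -
  have "bij_betw h {i \<in> {1..k}. (b \<circ> h) i = 1} {i \<in> {1..k}. b i = 1}"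
  proof (rule bij_betw_subset[OF assms])
    show "h ` {i \<in> {1..k}. (b \<circ> h) i = 1} = {i \<in> {1..k}. b i = 1}"
    proof (intro equalityI subsetI)
      fix i assume "i \<in> {i \<in> {1..k}. b i = 1}"
      moreover from this obtain j where "j \<in> {1..k}" "i = h j"
        using bij_betw_imp_surj_on[OF assms] by (metis (no_types, lifting) imageE mem_Collect_eq)
      ultimately show "i \<in> h ` {i \<in> {1..k}. (b \<circ> h) i = 1}" by simp
    qed (use bij_betwE[OF assms] in auto)
  qed blast
  then show ?thesis unfolding weight_def by (rule bij_betw_same_card)
qed

text \<open>The supports of \<open>a\<close> and \<open>b\<close> have equal size, and so do their
  complements in \<open>{1..k}\<close>; gluing a bijection on each part gives the permutation. It is
  the identity outside \<open>{1..k}\<close>, so that \<open>a = b \<circ> h\<close> holds as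
  functions and \<open>Pi_pmf\<close> can be reindexed along \<open>h\<close>.\<close>

lemma weight_eq_imp_reindex:
  assumes "a \<in> cube k" "b \<in> cube k" "weight k a = weight k b"
  obtains h where "bij_betw h {1..k} {1..k}" "\<And>i. i \<notin> {1..k} \<Longrightarrow> h i \<notin> {1..k}" "a = b \<circ> h"
proof -
  define A where "A = {i \<in> {1..k}. a i = 1}"
  define B where "B = {i \<in> {1..k}. b i = 1}"
  have sub: "A \<subseteq> {1..k}" "B \<subseteq> {1..k}" by (auto simp: A_def B_def)
  have fin: "finite A" "finite B" using sub by (auto intro: finite_subset)
  have card: "card A = card B" using assms(3) by (simp add: weight_def A_def B_def)
  obtain f where f: "bij_betw f A B" using card fin finite_same_card_bij by blast
  have "card ({1..k} - A) = card ({1..k} - B)"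
    using card sub fin by (simp add: card_Diff_subset)
  then obtain g where g: "bij_betw g ({1..k} - A) ({1..k} - B)"
    using finite_same_card_bij[of "{1..k} - A" "{1..k} - B"] by auto
  define h where "h = (\<lambda>i. if i \<in> A then f i else if i \<in> {1..k} then g i else i)"
  have "bij_betw h A B \<longleftrightarrow> bij_betw f A B"
    by (rule bij_betw_cong) (simp add: h_def)
  then have "bij_betw h A B" using f by simp
  moreover have "bij_betw h ({1..k} - A) ({1..k} - B) \<longleftrightarrow> bij_betw g ({1..k} - A) ({1..k} - B)"
    by (rule bij_betw_cong) (simp add: h_def)
  then have "bij_betw h ({1..k} - A) ({1..k} - B)" using g by simp
  ultimately have "bij_betw h (A \<union> ({1..k} - A)) (B \<union> ({1..k} - B))"
    by (rule bij_betw_combine) auto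
  moreover have "A \<union> ({1..k} - A) = {1..k}" "B \<union> ({1..k} - B) = {1..k}" using sub by auto
  ultimately have bij: "bij_betw h {1..k} {1..k}" by simp
  have "a i = b (h i)" for i
  proof -
    consider "i \<in> A" | "i \<in> {1..k} - A" | "i \<notin> {1..k}" by blast
    then show ?thesis
    proof cases
      case 1
      then have "h i \<in> B" using f by (auto simp: h_def bij_betw_def)
      with 1 show ?thesis by (simp add: A_def B_def)
    next
      case 2
      then have "h i \<in> {1..k} - B" using g by (auto simp: h_def bij_betw_def)
      with 2 show ?thesis by (auto simp: A_def B_def bit_not_one_iff)
    next
      case 3
      then have "i \<notin> A" "h i = i" using sub by (auto simp: h_def)
      with 3 show ?thesis using assms by (simp add: cube_def)
    qed
  qed
  then show ?thesis using bij sub by (intro that[of h]) (auto simp: h_def fun_eq_iff)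
qed

section \<open>Symmetrization over weight levels\<close>

definition level :: "nat \<Rightarrow> (nat \<Rightarrow> bit) \<Rightarrow> (nat \<Rightarrow> bit) set" where
  "level k b = {a \<in> cube k. weight k a = weight k b}"

lemma mem_level: "a \<in> level k b \<longleftrightarrow> a \<in> cube k \<and> weight k a = weight k b"
  by (simp add: level_def)

lemma finite_level [simp]: "finite (level k b)"
  by (rule finite_subset[OF _ finite_cube]) (auto simp: level_def)

text \<open>Truncating \<open>b\<close> to \<open>{1..k}\<close> keeps its weight, so this covers
  vectors outside the cube too and \<open>symmetrize\<close> is meaningful for every
  distribution.\<close>

lemma level_nonempty [simp]: "level k b \<noteq> {}"
proof -
  have "(\<lambda>i. if i \<in> {1..k} then b i else 0) \<in> level k b"
    by (auto simp: level_def cube_def weight_def intro!: arg_cong[where f = card])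
  then show ?thesis by blast
qed

definition symmetrize :: "nat \<Rightarrow> (nat \<Rightarrow> bit) pmf \<Rightarrow> (nat \<Rightarrow> bit) pmf" where
  "symmetrize k D = D \<bind> (\<lambda>b. pmf_of_set (level k b))"

lemma symmetrize_in_symm_dists: "symmetrize k D \<in> symm_dists k"
proof -
  have "pmf (symmetrize k D) a = pmf (symmetrize k D) b"
    if "a \<in> cube k" "b \<in> cube k" "weight k a = weight k b" for a b
    unfolding symmetrize_def pmf_bind
    by (intro Bochner_Integration.integral_cong refl)
      (use that in \<open>simp add: pmf_of_set mem_level indicator_def\<close>)
  moreover have "set_pmf (symmetrize k D) \<subseteq> cube k"
    by (auto simp: symmetrize_def mem_level)
  ultimately show ?thesis unfolding symm_dists_def by blast
qed

text \<open>After the shift by 1 a coordinate \<open>1\<close> counts +1 and a coordinate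
  \<open>0\<close> counts -1.\<close>

lemma sum_sign_weight:
  "(\<Sum>i\<in>{1..k}. sign_bit (a i + 1)) = 2 * real (weight k a) - real k"
proof -
  have "sign_bit (a i + 1) = 2 * of_bool (a i = 1) - 1" for i
    by (cases "a i") (auto simp: sign_bit_def)
  then show ?thesis
    by (simp add: sum_subtractf sum_distrib_left[symmetric] weight_def Int_def)
qed

text \<open>Transposing the coordinates 1 and \<open>i\<close> permutes the level, so all
  coordinates have the same mean as the first one. Their \<open>k\<close> signs add up to a constant
  on the level, and \<open>mu\<close> is the average of that constant over the coordinates.\<close>

lemma mu_pmf_of_set_level:
  assumes "1 \<le> k"
  shows "mu (pmf_of_set (level k b)) = (2 * real (weight k b) - real k) / real k"
proof -
  let ?M = "pmf_of_set (level k b)"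
  have swap: "measure_pmf.expectation ?M (\<lambda>a. sign_bit (a i + 1)) = mu ?M" if i: "i \<in> {1..k}" for i
  proof -
    define h where "h = (\<lambda>j. if j = 1 then i else if j = i then 1 else j)"
    have hh: "h (h j) = j" for j by (simp add: h_def)
    have bij: "bij_betw h {1..k} {1..k}"
      by (rule bij_betw_byWitness[where f' = h]) (use i assms hh in \<open>auto simp: h_def\<close>)
    have hout: "h j \<notin> {1..k}" if "j \<notin> {1..k}" for j
      using that i assms by (auto simp: h_def)
    have "a \<circ> h \<in> level k b" if "a \<in> level k b" for a
      using that hout weight_reindex[OF bij] by (auto simp: level_def cube_def)
    then have "bij_betw (\<lambda>a. a \<circ> h) (level k b) (level k b)"
      by (intro bij_betw_byWitness[where f' = "\<lambda>a. a \<circ> h"]) (auto simp: hh fun_eq_iff)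
    then have M: "map_pmf (\<lambda>a. a \<circ> h) ?M = ?M"
      by (metis bij_betw_def finite_level level_nonempty map_pmf_of_set_inj)
    have "mu ?M = measure_pmf.expectation (map_pmf (\<lambda>a. a \<circ> h) ?M) (\<lambda>a. sign_bit (a 1 + 1))"
      by (simp add: M mu_def)
    also have "\<dots> = measure_pmf.expectation ?M (\<lambda>a. sign_bit (a i + 1))"
      by (simp add: h_def)
    finally show ?thesis by simp
  qed
  have "real k * mu ?M = (\<Sum>i\<in>{1..k}. measure_pmf.expectation ?M (\<lambda>a. sign_bit (a i + 1)))"
    using swap by simp
  also have "\<dots> = measure_pmf.expectation ?M (\<lambda>a. \<Sum>i\<in>{1..k}. sign_bit (a i + 1))"
    by (rule Bochner_Integration.integral_sum[symmetric])
      (auto intro: integrable_measure_pmf_finite)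
  also have "\<dots> = measure_pmf.expectation ?M (\<lambda>a. 2 * real (weight k b) - real k)"
    unfolding sum_sign_weight
    by (intro integral_cong_AE) (auto simp: AE_measure_pmf_iff mem_level)
  finally show ?thesis using assms by (simp add: field_simps)
qed

lemma mu_bind:
  assumes "finite (set_pmf M)" "\<And>x. x \<in> set_pmf M \<Longrightarrow> finite (set_pmf (f x))"
  shows "mu (M \<bind> f) = measure_pmf.expectation M (\<lambda>x. mu (f x))"
  unfolding mu_def using assms
  by (simp add: pmf_expectation_bind[of "set_pmf M"] integral_measure_pmf[of "set_pmf M"])

lemma mu_symmetrize:
  assumes "1 \<le> k" "finite (set_pmf D)"
  shows "mu (symmetrize k D) =
    measure_pmf.expectation D (\<lambda>b. (2 * real (weight k b) - real k) / real k)"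
  unfolding symmetrize_def using assms
  by (simp add: mu_bind mu_pmf_of_set_level)

section \<open>Reindexing the Bernoulli noise\<close>

lemma bern_power_reindex:
  assumes "bij_betw h {1..k} {1..k}" "\<And>i. i \<notin> {1..k} \<Longrightarrow> h i \<notin> {1..k}"
  shows "map_pmf (\<lambda>a. a \<circ> h) (bern_power k p) = bern_power k p"
  unfolding bern_power_def using Pi_pmf_bij_betw[OF _ assms, of "0::bit"] by simp

text \<open>A constraint reads the noise at distinct variables, so the \<open>k\<close> bits it sees
  are again independent: restrict the product to the image of \<open>j\<close>, then rename.\<close>

lemma bern_power_pullback:
  assumes "inj_on j {1..k}" "j ` {1..k} \<subseteq> {1..n}"
  shows "map_pmf (\<lambda>a i. if i \<in> {1..k} then a (j i) else 0) (bern_power n p) = bern_power k p"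
proof -
  define J where "J = j ` {1..k}"
  \<comment> \<open>Indices outside \<open>{1..k}\<close> go to \<open>0\<close>, which is not in
    \<open>J\<close> because variables are numbered from 1; there the renamed vector takes the
    default bit \<open>0\<close>.\<close>
  define h where "h = (\<lambda>i. if i \<in> {1..k} then j i else 0)"
  have 0: "0 \<notin> J" using assms by (auto simp: J_def)
  have "bij_betw h {1..k} J \<longleftrightarrow> bij_betw j {1..k} J"
    by (rule bij_betw_cong) (simp add: h_def)
  then have bij: "bij_betw h {1..k} J"
    using assms(1) by (simp only: J_def inj_on_imp_bij_betw)
  have "bern_power k p = map_pmf (\<lambda>a. a \<circ> h) (Pi_pmf J 0 (\<lambda>_. bern p))"
    unfolding bern_power_def
    by (rule Pi_pmf_bij_betw[OF _ bij]) (use 0 in \<open>auto simp: h_def\<close>)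
  also have "Pi_pmf J 0 (\<lambda>_. bern p) =
      map_pmf (\<lambda>a i. if i \<in> J then a i else 0) (bern_power n p)"
    unfolding bern_power_def using assms by (intro Pi_pmf_subset) (auto simp: J_def)
  also have "map_pmf (\<lambda>a. a \<circ> h) \<dots> =
      map_pmf (\<lambda>a i. if i \<in> {1..k} then a (j i) else 0) (bern_power n p)"
    unfolding pmf.map_comp
    by (rule map_pmf_cong[OF refl]) (use 0 in \<open>auto simp: h_def J_def fun_eq_iff\<close>)
  finally show ?thesis by simp
qed

section \<open>From weighted sums to probabilities\<close>

lemma sum_mset_eq_sum_count:
  fixes f :: "'a \<Rightarrow> real"
  shows "(\<Sum>x\<in>#M. f x) = (\<Sum>x\<in>set_mset M. real (count M x) * f x)"
proof -
  have "(\<Sum>x\<in>#M. f x) = (\<Sum>x\<in>#M. \<Sum>y\<in>set_mset M. if x = y then f y else 0)"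
    by (intro arg_cong[where f = sum_mset] image_mset_cong) simp
  also have "\<dots> = (\<Sum>y\<in>set_mset M. \<Sum>x\<in>#M. if x = y then f y else 0)"
    unfolding sum_unfold_sum_mset by (rule sum_mset.swap)
  also have "\<dots> = (\<Sum>y\<in>set_mset M. real (count M y) * f y)"
    by (simp add: sum_mset_delta mult.commute)
  finally show ?thesis .
qed

text \<open>Each element is drawn with probability proportional to its total weight, where
  repetitions enter through \<open>count\<close>. Ratios such as \<open>csp_val\<close> thereby
  become expectations.\<close>

lemma weighted_pmf:
  fixes w :: "'a \<Rightarrow> real"
  assumes nonneg: "\<And>x. x \<in># M \<Longrightarrow> 0 \<le> w x" and pos: "0 < (\<Sum>x\<in>#M. w x)"
  obtains P where "set_pmf P \<subseteq> set_mset M"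
    "\<And>g. measure_pmf.expectation P g = (\<Sum>x\<in>#M. w x * g x) / (\<Sum>x\<in>#M. w x)"
proof -
  define W where "W = (\<Sum>x\<in>#M. w x)"
  define q where "q x = real (count M x) * w x / W" for x
  have q0: "0 \<le> q x" for x
    using nonneg[of x] pos by (cases "x \<in># M") (auto simp: q_def W_def not_in_iff)
  have "(\<integral>\<^sup>+x. ennreal (q x) \<partial>count_space UNIV) = (\<Sum>x\<in>set_mset M. ennreal (q x))"
    by (rule nn_integral_count_space') (auto simp: q_def not_in_iff)
  also have "\<dots> = ennreal (\<Sum>x\<in>set_mset M. q x)"
    using q0 by simp
  also have "(\<Sum>x\<in>set_mset M. q x) = 1"
    using pos unfolding q_def sum_divide_distrib[symmetric] W_def sum_mset_eq_sum_count by simp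
  finally have one: "(\<integral>\<^sup>+x. ennreal (q x) \<partial>count_space UNIV) = 1" by simp
  define P where "P = embed_pmf q"
  have P: "pmf P x = q x" for x unfolding P_def using q0 one by (rule pmf_embed_pmf)
  have set: "set_pmf P \<subseteq> set_mset M"
    by (auto simp: set_pmf_eq P q_def not_in_iff)
  have "measure_pmf.expectation P g = (\<Sum>x\<in>#M. w x * g x) / (\<Sum>x\<in>#M. w x)" for g
  proof -
    have "measure_pmf.expectation P g = (\<Sum>x\<in>set_mset M. q x * g x)"
      using set by (subst integral_measure_pmf[of "set_mset M"]) (auto simp: P)
    also have "\<dots> = (\<Sum>x\<in>#M. w x * g x) / W"
      unfolding sum_mset_eq_sum_count[of "\<lambda>x. w x * g x"] sum_divide_distrib
      by (intro sum.cong) (simp_all add: q_def)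
    finally show ?thesis by (simp add: W_def)
  qed
  with set show ?thesis by (rule that)
qed

text \<open>Reading the mean of an indicator as the mass of \<open>True\<close> turns the exchange
  of two expectations into commutation of \<open>bind\<close>.\<close>

lemma pmf_map_True:
  "pmf (map_pmf h M) True = measure_pmf.expectation M (\<lambda>x. of_bool (h x))"
  unfolding map_pmf_def pmf_bind
  by (intro Bochner_Integration.integral_cong refl) (simp add: indicator_def)

section \<open>The functionals \<lambda> and \<gamma> as acceptance probabilities\<close>

lemma symm_pred_cong:
  assumes "\<And>i. i \<in> {1..k} \<Longrightarrow> a i = b i"
  shows "symm_pred k S a = symm_pred k S b"
proof -
  have "{i \<in> {1..k}. a i = 1} = {i \<in> {1..k}. b i = 1}" using assms by auto
  then show ?thesis by (simp only: symm_pred_def weight_def)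
qed

text \<open>The total weight of the canonical instance is 1 because \<open>D\<close> lives on the
  cube, and the truncation in \<open>satisfies\<close> is invisible to a symmetric
  predicate.\<close>

lemma csp_val_canonical:
  assumes "set_pmf D \<subseteq> cube k"
  shows "csp_val k (symm_pred k S) (canonical k D) a =
    pmf (map_pmf (\<lambda>b. symm_pred k S (\<lambda>i. b i + a i)) D) True"
proof -
  have sat: "satisfies k (symm_pred k S) a \<lparr>neg = b, idx = (\<lambda>t. t), wgt = v\<rparr> =
      symm_pred k S (\<lambda>i. b i + a i)" for b v
    unfolding satisfies_def by (rule symm_pred_cong) simp
  have "csp_val k (symm_pred k S) (canonical k D) a =
      (\<Sum>b\<in>cube k. pmf D b * of_bool (symm_pred k S (\<lambda>i. b i + a i))) / (\<Sum>b\<in>cube k. pmf D b)"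
    unfolding csp_val_def canonical_def sum_unfold_sum_mset
    by (simp add: image_mset.compositionality comp_def sat)
  also have "(\<Sum>b\<in>cube k. pmf D b) = 1"
    using assms by (simp add: sum_pmf_eq_1)
  finally show ?thesis
    using assms by (simp add: pmf_map_True integral_measure_pmf[of "cube k"] subset_iff)
qed

text \<open>The two independent draws are exchanged: noise now comes after the pattern
  \<open>b\<close>, which allows arguments for one fixed pattern at a time.\<close>

lemma lam_eq_pmf:
  assumes "set_pmf D \<subseteq> cube k"
  shows "lam k S D p =
    pmf (D \<bind> (\<lambda>b. map_pmf (\<lambda>a. symm_pred k S (\<lambda>i. b i + a i)) (bern_power k p))) True"
proof -
  have "lam k S D p =
      pmf (bern_power k p \<bind> (\<lambda>a. map_pmf (\<lambda>b. symm_pred k S (\<lambda>i. b i + a i)) D)) True"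
    unfolding lam_def pmf_bind csp_val_canonical[OF assms] ..
  also have "bern_power k p \<bind> (\<lambda>a. map_pmf (\<lambda>b. symm_pred k S (\<lambda>i. b i + a i)) D) =
      D \<bind> (\<lambda>b. map_pmf (\<lambda>a. symm_pred k S (\<lambda>i. b i + a i)) (bern_power k p))"
    unfolding map_pmf_def by (rule bind_commute_pmf)
  finally show ?thesis .
qed

lemma lam_nonneg: "set_pmf D \<subseteq> cube k \<Longrightarrow> 0 \<le> lam k S D p"
  by (simp add: lam_eq_pmf)

text \<open>The parameter is the probability of the bit \<open>0\<close>, so \<open>p = 1\<close> is
  the noiseless case, the one that defines \<open>gam\<close>.\<close>

lemma bern_1: "bern 1 = return_pmf 0"
proof -
  have "pmf (bernoulli_pmf 1) z = pmf (return_pmf True) z" for z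
    by (cases z) auto
  then have "bernoulli_pmf 1 = return_pmf True" by (rule pmf_eqI)
  then show ?thesis by (simp add: bern_def)
qed

lemma bern_power_1: "bern_power k 1 = return_pmf (\<lambda>_. 0)"
  unfolding bern_power_def bern_1 by simp

lemma gam_eq_pmf:
  assumes "set_pmf D \<subseteq> cube k"
  shows "gam k S D = pmf (map_pmf (symm_pred k S) D) True"
  unfolding gam_def lam_eq_pmf[OF assms] bern_power_1 map_pmf_def bind_return_pmf add_0_right ..

text \<open>A permutation carrying \<open>b\<close> to \<open>a\<close> preserves both the law of
  the noise and the weight of the noisy vector.\<close>

lemma symm_pred_noise_cong:
  assumes "a \<in> cube k" "b \<in> cube k" "weight k a = weight k b"
  shows "map_pmf (\<lambda>c. symm_pred k S (\<lambda>i. a i + c i)) (bern_power k p) =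
    map_pmf (\<lambda>c. symm_pred k S (\<lambda>i. b i + c i)) (bern_power k p)"
proof -
  obtain h where h: "bij_betw h {1..k} {1..k}" "\<And>i. i \<notin> {1..k} \<Longrightarrow> h i \<notin> {1..k}" "a = b \<circ> h"
    using weight_eq_imp_reindex[OF assms] by metis
  have reindex: "map_pmf (\<lambda>c. c \<circ> h) (bern_power k p) = bern_power k p"
    using h(1,2) by (rule bern_power_reindex)
  have "map_pmf (\<lambda>c. symm_pred k S (\<lambda>i. a i + c i)) (bern_power k p) =
      map_pmf (\<lambda>c. symm_pred k S (\<lambda>i. a i + c i)) (map_pmf (\<lambda>c. c \<circ> h) (bern_power k p))"
    unfolding reindex ..
  also have "\<dots> = map_pmf (\<lambda>c. symm_pred k S ((\<lambda>i. b i + c i) \<circ> h)) (bern_power k p)"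
    unfolding pmf.map_comp h(3) comp_def ..
  also have "\<dots> = map_pmf (\<lambda>c. symm_pred k S (\<lambda>i. b i + c i)) (bern_power k p)"
    unfolding symm_pred_def weight_reindex[OF h(1)] ..
  finally show ?thesis .
qed

lemma set_pmf_symmetrize: "set_pmf (symmetrize k D) \<subseteq> cube k"
  using symmetrize_in_symm_dists unfolding symm_dists_def by blast

text \<open>Within a level the acceptance probability under noise is constant, so resampling the
  pattern in its level changes nothing.\<close>

lemma lam_symmetrize:
  assumes "set_pmf D \<subseteq> cube k"
  shows "lam k S (symmetrize k D) p =
    pmf (D \<bind> (\<lambda>b. map_pmf (\<lambda>a. symm_pred k S (\<lambda>i. b i + a i)) (bern_power k p))) True"
proof -
  define N where "N b = map_pmf (\<lambda>a. symm_pred k S (\<lambda>i. b i + a i)) (bern_power k p)" for b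
  have "symmetrize k D \<bind> N = D \<bind> N"
    unfolding symmetrize_def bind_assoc_pmf
  proof (rule bind_pmf_cong[OF refl])
    fix b assume "b \<in> set_pmf D"
    then have b: "b \<in> cube k" using assms by blast
    have "pmf_of_set (level k b) \<bind> N = pmf_of_set (level k b) \<bind> (\<lambda>_. N b)"
    proof (rule bind_pmf_cong[OF refl])
      fix a assume "a \<in> set_pmf (pmf_of_set (level k b))"
      then have "a \<in> cube k" "weight k a = weight k b" by (simp_all add: mem_level)
      with b show "N a = N b" unfolding N_def by (intro symm_pred_noise_cong)
    qed
    then show "pmf_of_set (level k b) \<bind> N = N b" by simp
  qed
  then show ?thesis
    unfolding lam_eq_pmf[OF set_pmf_symmetrize] N_def by simp
qed

section \<open>The pattern distribution of an assignment\<close>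

definition pattern :: "nat \<Rightarrow> (nat \<Rightarrow> bit) \<Rightarrow> bconstraint \<Rightarrow> nat \<Rightarrow> bit" where
  "pattern k x C = (\<lambda>t. if t \<in> {1..k} then neg C t + x (idx C t) else 0)"

lemma pattern_in_cube: "pattern k x C \<in> cube k"
  by (simp add: pattern_def cube_def)

lemma gam_symmetrize:
  assumes "set_pmf D \<subseteq> cube k"
  shows "gam k S (symmetrize k D) = pmf (map_pmf (symm_pred k S) D) True"
  unfolding gam_def lam_symmetrize[OF assms] bern_power_1 map_pmf_def bind_return_pmf add_0_right ..

text \<open>\<open>P\<close> draws a constraint with probability proportional to weight. Fixing it
  through its expectations gives values and means directly as weighted sums over
  \<open>\<Psi>\<close>.\<close>

locale constraint_pmf =
  fixes k n :: nat and \<Psi> :: bcsp and P :: "bconstraint pmf"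
  assumes k_pos: "1 \<le> k"
    and inst: "bcsp_instance n k \<Psi>"
    and weight_pos: "0 < (\<Sum>C\<in>#\<Psi>. wgt C)"
    and set_P: "set_pmf P \<subseteq> set_mset \<Psi>"
    and expectation_P:
      "\<And>g. measure_pmf.expectation P g = (\<Sum>C\<in>#\<Psi>. wgt C * g C) / (\<Sum>C\<in>#\<Psi>. wgt C)"
begin

definition pattern_dist :: "(nat \<Rightarrow> bit) \<Rightarrow> (nat \<Rightarrow> bit) pmf" where
  "pattern_dist x = map_pmf (pattern k x) P"

lemma set_pattern_dist: "set_pmf (pattern_dist x) \<subseteq> cube k"
  by (auto simp: pattern_dist_def pattern_in_cube)

lemma finite_set_P: "finite (set_pmf P)"
  using set_P by (rule finite_subset) simp

lemma csp_val_eq_pmf: "csp_val k f \<Psi> x = pmf (map_pmf (\<lambda>C. f (pattern k x C)) P) True"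
  unfolding pmf_map_True expectation_P csp_val_def satisfies_def pattern_def ..

lemma csp_val_eq_gam:
  "csp_val k (symm_pred k S) \<Psi> x = gam k S (symmetrize k (pattern_dist x))"
  unfolding gam_symmetrize[OF set_pattern_dist] csp_val_eq_pmf
  by (simp add: pattern_dist_def pmf.map_comp comp_def)

text \<open>Draw the constraint before the noise. For a fixed constraint the noise is simply added
  to its pattern, and by distinctness of the indices the bits it meets have law
  \<open>bern_power k p\<close>.\<close>

lemma expectation_noisy_csp_val:
  "measure_pmf.expectation (bern_power n p) (\<lambda>a. csp_val k (symm_pred k S) \<Psi> (\<lambda>i. x i + a i)) =
    lam k S (symmetrize k (pattern_dist x)) p"
proof -
  let ?f = "symm_pred k S"
  have "measure_pmf.expectation (bern_power n p) (\<lambda>a. csp_val k ?f \<Psi> (\<lambda>i. x i + a i)) =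
      pmf (bern_power n p \<bind> (\<lambda>a. map_pmf (\<lambda>C. ?f (pattern k (\<lambda>i. x i + a i) C)) P)) True"
    unfolding csp_val_eq_pmf pmf_bind ..
  also have "bern_power n p \<bind> (\<lambda>a. map_pmf (\<lambda>C. ?f (pattern k (\<lambda>i. x i + a i) C)) P) =
      P \<bind> (\<lambda>C. map_pmf (\<lambda>a. ?f (pattern k (\<lambda>i. x i + a i) C)) (bern_power n p))"
    unfolding map_pmf_def by (rule bind_commute_pmf)
  also have "\<dots> = P \<bind> (\<lambda>C. map_pmf (\<lambda>a. ?f (\<lambda>i. pattern k x C i + a i)) (bern_power k p))"
  proof (rule bind_pmf_cong[OF refl])
    fix C assume "C \<in> set_pmf P"
    then have C: "inj_on (idx C) {1..k}" "idx C ` {1..k} \<subseteq> {1..n}"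
      using set_P inst unfolding bcsp_instance_def by blast+
    have "?f (pattern k (\<lambda>i. x i + a i) C) =
        ?f (\<lambda>i. pattern k x C i + (if i \<in> {1..k} then a (idx C i) else 0))" for a
      by (rule symm_pred_cong) (simp only: pattern_def if_True add.assoc)
    then show "map_pmf (\<lambda>a. ?f (pattern k (\<lambda>i. x i + a i) C)) (bern_power n p) =
        map_pmf (\<lambda>a. ?f (\<lambda>i. pattern k x C i + a i)) (bern_power k p)"
      unfolding bern_power_pullback[OF C, of p, symmetric] pmf.map_comp comp_def by simp
  qed
  also have "\<dots> = pattern_dist x \<bind> (\<lambda>b. map_pmf (\<lambda>a. ?f (\<lambda>i. b i + a i)) (bern_power k p))"
    unfolding pattern_dist_def bind_map_pmf ..
  finally show ?thesis unfolding lam_symmetrize[OF set_pattern_dist] .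
qed

text \<open>Double counting: the pairs of a constraint and a position are grouped by the variable
  found there.\<close>

lemma sum_bias:
  "(\<Sum>C\<in>#\<Psi>. \<Sum>t\<in>{1..k}. sign_bit (neg C t) * wgt C * c (idx C t)) = (\<Sum>i\<in>{1..n}. bias k \<Psi> i * c i)"
proof -
  have "(\<Sum>i\<in>{1..n}. bias k \<Psi> i * c i) =
      (\<Sum>i\<in>{1..n}. \<Sum>C\<in>#\<Psi>. \<Sum>t | t \<in> {1..k} \<and> idx C t = i. sign_bit (neg C t) * wgt C * c (idx C t))"
    unfolding bias_def sum_mset_distrib_right sum_distrib_right
    by (intro sum.cong refl arg_cong[where f = sum_mset] image_mset_cong) auto
  also have "\<dots> = (\<Sum>C\<in>#\<Psi>. \<Sum>i\<in>{1..n}.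
      \<Sum>t | t \<in> {1..k} \<and> idx C t = i. sign_bit (neg C t) * wgt C * c (idx C t))"
    unfolding sum_unfold_sum_mset[of _ "{1..n}"] by (rule sum_mset.swap)
  also have "\<dots> = (\<Sum>C\<in>#\<Psi>. \<Sum>t\<in>{1..k}. sign_bit (neg C t) * wgt C * c (idx C t))"
  proof (intro arg_cong[where f = sum_mset] image_mset_cong)
    fix C assume "C \<in># \<Psi>"
    then have "idx C ` {1..k} \<subseteq> {1..n}"
      using inst unfolding bcsp_instance_def by blast
    then show "(\<Sum>i\<in>{1..n}. \<Sum>t | t \<in> {1..k} \<and> idx C t = i. sign_bit (neg C t) * wgt C * c (idx C t)) =
        (\<Sum>t\<in>{1..k}. sign_bit (neg C t) * wgt C * c (idx C t))"
      by (intro sum.group) auto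
  qed
  finally show ?thesis by simp
qed

text \<open>The sign of a pattern bit factors into the sign of the negation and that of the
  variable, so collecting by variable yields the biases. The minus sign stems from the shift by 1 in
  \<open>mu\<close>.\<close>

lemma mu_pattern_dist:
  "mu (symmetrize k (pattern_dist x)) =
    (\<Sum>i\<in>{1..n}. bias k \<Psi> i * - sign_bit (x i)) / (real k * (\<Sum>C\<in>#\<Psi>. wgt C))"
proof -
  have sign: "sign_bit (b + c + 1) = sign_bit b * - sign_bit c" for b c
    by (cases b; cases c) (auto simp: sign_bit_def)
  have fin: "finite (set_pmf (pattern_dist x))"
    using finite_set_P by (simp add: pattern_dist_def)
  have summand: "wgt C * ((2 * real (weight k (pattern k x C)) - real k) / real k) =
      (\<Sum>t\<in>{1..k}. sign_bit (neg C t) * wgt C * - sign_bit (x (idx C t))) / real k" for C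
  proof -
    have "2 * real (weight k (pattern k x C)) - real k =
        (\<Sum>t\<in>{1..k}. sign_bit (neg C t) * - sign_bit (x (idx C t)))"
      unfolding sum_sign_weight[symmetric]
      by (intro sum.cong refl) (simp only: pattern_def if_True sign)
    then show ?thesis
      by (simp add: sum_distrib_left mult_ac)
  qed
  have "mu (symmetrize k (pattern_dist x)) =
      measure_pmf.expectation P (\<lambda>C. (2 * real (weight k (pattern k x C)) - real k) / real k)"
    unfolding mu_symmetrize[OF k_pos fin] by (simp add: pattern_dist_def)
  also have "\<dots> = (\<Sum>C\<in>#\<Psi>. (\<Sum>t\<in>{1..k}. sign_bit (neg C t) * wgt C * - sign_bit (x (idx C t))) / real k) /
      (\<Sum>C\<in>#\<Psi>. wgt C)"
    unfolding expectation_P summand ..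
  also have "\<dots> = (\<Sum>C\<in>#\<Psi>. \<Sum>t\<in>{1..k}. sign_bit (neg C t) * wgt C * - sign_bit (x (idx C t))) /
      real k / (\<Sum>C\<in>#\<Psi>. wgt C)"
    by (simp add: divide_inverse sum_mset_distrib_right)
  finally show ?thesis unfolding sum_bias[of "\<lambda>i. - sign_bit (x i)"] by simp
qed

text \<open>The bound holds term by term: the greedy choice makes the contribution of variable
  \<open>i\<close> equal to the absolute value of its bias.\<close>

lemma mu_le_mu_greedy:
  "mu (symmetrize k (pattern_dist x)) \<le> mu (symmetrize k (pattern_dist (greedy n k \<Psi>)))"
  unfolding mu_pattern_dist
proof (intro divide_right_mono sum_mono)
  fix i assume "i \<in> {1..n}"
  then show "bias k \<Psi> i * - sign_bit (x i) \<le> bias k \<Psi> i * - sign_bit (greedy n k \<Psi> i)"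
    by (simp add: greedy_def sign_bit_def)
qed (use weight_pos in simp)

end

section \<open>Monotonicity of \<gamma> in the mean for thresholds\<close>

lemma symm_distsD: "D \<in> symm_dists k \<Longrightarrow> set_pmf D \<subseteq> cube k"
  by (simp add: symm_dists_def)

lemma mu_le_1: "mu D \<le> 1"
proof -
  have "mu D \<le> measure_pmf.expectation D (\<lambda>_. 1)"
    unfolding mu_def
    by (intro integral_mono measure_pmf.integrable_const_bound[where B = 1])
      (auto simp: sign_bit_def)
  then show ?thesis by simp
qed

lemma weight_eq_k_iff:
  assumes "b \<in> cube k"
  shows "weight k b = k \<longleftrightarrow> b = (\<lambda>i. if i \<in> {1..k} then 1 else 0)"
proof
  assume "weight k b = k"
  then have "{i \<in> {1..k}. b i = 1} = {1..k}"
    by (intro card_subset_eq) (auto simp: weight_def)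
  then show "b = (\<lambda>i. if i \<in> {1..k} then 1 else 0)"
    using assms by (auto simp: cube_def fun_eq_iff set_eq_iff)
next
  assume b: "b = (\<lambda>i. if i \<in> {1..k} then 1 else 0)"
  have "{i \<in> {1..k}. b i = 1} = {1..k}" unfolding b by auto
  then show "weight k b = k" unfolding weight_def by simp
qed

text \<open>\<open>D'\<close> mixes \<open>D\<close> with the point mass at the all-ones vector
  \<open>u\<close>. That point mass is symmetric, as \<open>u\<close> is alone in its level; it has
  mean 1, and \<open>t \<le> k\<close> makes the threshold accept it.\<close>

lemma gam_mixture:
  assumes "1 \<le> k" "t \<le> k" and D: "D \<in> symm_dists k" and c: "0 \<le> c" "c \<le> 1"
  obtains D' where "D' \<in> symm_dists k" "mu D' = c + (1 - c) * mu D" 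
    "gam k {t..k} D' = c + (1 - c) * gam k {t..k} D"
proof -
  define u :: "nat \<Rightarrow> bit" where "u = (\<lambda>i. if i \<in> {1..k} then 1 else 0)"
  have u: "u \<in> cube k" by (simp add: u_def cube_def)
  then have wu: "weight k u = k" by (simp add: weight_eq_k_iff u_def)
  define M where "M z = (if z then return_pmf u else D)" for z
  define D' where "D' = bernoulli_pmf c \<bind> M"
  have setD: "set_pmf D \<subseteq> cube k" using D by (rule symm_distsD)
  then have fin: "finite (set_pmf D)" by (rule finite_subset) simp
  have setD': "set_pmf D' \<subseteq> cube k"
    using setD u by (auto simp: D'_def M_def split: if_splits)
  have pmfD': "pmf D' a = c * indicator {u} a + (1 - c) * pmf D a" for a
    unfolding D'_def pmf_bind using c by (simp add: M_def indicator_def)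
  have "pmf D' a = pmf D' b" if ab: "a \<in> cube k" "b \<in> cube k" "weight k a = weight k b" for a b
  proof -
    have "pmf D a = pmf D b" using D ab unfolding symm_dists_def by blast
    moreover have "a = u \<longleftrightarrow> b = u"
      using ab weight_eq_k_iff[of a k] weight_eq_k_iff[of b k] unfolding u_def by metis
    ultimately show ?thesis by (simp add: pmfD' indicator_def)
  qed
  with setD' have "D' \<in> symm_dists k" unfolding symm_dists_def by blast
  moreover have "mu D' = c + (1 - c) * mu D"
  proof -
    have "mu (return_pmf u) = 1" using assms(1) by (simp add: mu_def u_def sign_bit_def)
    moreover have "mu D' = measure_pmf.expectation (bernoulli_pmf c) (\<lambda>z. mu (M z))"
      unfolding D'_def by (rule mu_bind) (simp_all add: M_def fin)
    ultimately show ?thesis using c by (simp add: M_def)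
  qed
  moreover have "gam k {t..k} D' = c + (1 - c) * gam k {t..k} D"
    unfolding gam_eq_pmf[OF setD'] gam_eq_pmf[OF setD] unfolding D'_def map_bind_pmf pmf_bind
    using c assms(2) by (simp add: M_def symm_pred_def wu)
  ultimately show ?thesis by (rule that)
qed

lemma gam_le_gam_mu:
  assumes "1 \<le> k" "t \<le> k" and D: "D \<in> symm_dists k" and m: "mu D \<le> m" "m \<le> 1"
  shows "gam k {t..k} D \<le> gam_mu k {t..k} m"
proof -
  \<comment> \<open>\<open>c\<close> solves \<open>c + (1 - c) * mu D = m\<close>. If
    \<open>mu D = 1\<close>, then \<open>m = 1\<close> and division by zero gives
    \<open>c = 0\<close>, which is still a solution.\<close>
  define c where "c = (m - mu D) / (1 - mu D)"
  have c: "0 \<le> c" "c \<le> 1" "c + (1 - c) * mu D = m"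
    using m by (auto simp: c_def divide_simps) (auto simp: algebra_simps)
  obtain D' where D': "D' \<in> symm_dists k" "mu D' = c + (1 - c) * mu D"
      "gam k {t..k} D' = c + (1 - c) * gam k {t..k} D"
    using gam_mixture[OF assms(1,2) D c(1,2)] .
  have gam1: "gam k {t..k} E \<le> 1" if "E \<in> symm_dists k" for E
    using symm_distsD[OF that] by (simp add: gam_eq_pmf pmf_le_1)
  \<comment> \<open>Since \<open>gam\<close> is at most 1, moving it towards 1 by the mixture cannot
    lower it.\<close>
  have "c * gam k {t..k} D \<le> c * 1" using gam1[OF D] c(1) by (rule mult_left_mono)
  then have "gam k {t..k} D \<le> gam k {t..k} D'" by (simp add: D'(3) algebra_simps)
  also have "\<dots> \<le> gam_mu k {t..k} m"
    unfolding gam_mu_def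
    by (rule cSUP_upper) (use D' c gam1 in \<open>auto intro!: bdd_aboveI[where M = 1]\<close>)
  finally show ?thesis .
qed

section \<open>Optimum, rounding and the max-min bound\<close>

lemma csp_val_eq_0:
  assumes "(\<Sum>C\<in>#\<Psi>. wgt C) = 0"
  shows "csp_val k f \<Psi> x = 0"
  using assms by (simp add: csp_val_def)

lemma rounding_expectation:
  fixes f :: "(nat \<Rightarrow> bit) \<Rightarrow> real"
  shows "measure_pmf.expectation (rounding n k \<Psi> p) f =
    measure_pmf.expectation (bern_power n p) (\<lambda>a. f (\<lambda>i. greedy n k \<Psi> i + a i))"
  unfolding rounding_def integral_map_pmf ..

lemma csp_opt_attained: obtains x where "csp_opt n k f \<Psi> = csp_val k f \<Psi> x"
proof -
  have "(\<lambda>_. 0) \<in> cube n" by (simp add: cube_def)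
  then have "csp_opt n k f \<Psi> \<in> csp_val k f \<Psi> ` cube n"
    unfolding csp_opt_def by (intro Max_in) auto
  then show ?thesis using that by auto
qed

text \<open>The ratio of \<open>D\<close> itself witnesses that the set is nonempty, and 0 bounds it
  from below, so the real \<open>Inf\<close> is a true infimum.\<close>

lemma max_min_value_bounds:
  assumes D: "D \<in> symm_dists k" "0 < gam_mu k S (mu D)"
  shows "0 \<le> max_min_value k S p" "max_min_value k S p * gam_mu k S (mu D) \<le> lam k S D p"
proof -
  let ?R = "{lam k S D p / gam_mu k S (mu D) | D. D \<in> symm_dists k \<and> gam_mu k S (mu D) > 0}"
  have R: "lam k S D p / gam_mu k S (mu D) \<in> ?R" using D by blast
  have nonneg: "0 \<le> r" if "r \<in> ?R" for r
    using that by (auto intro!: divide_nonneg_nonneg lam_nonneg dest: symm_distsD)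
  show "0 \<le> max_min_value k S p"
    unfolding max_min_value_def using R nonneg by (intro cInf_greatest) blast+
  have "max_min_value k S p \<le> lam k S D p / gam_mu k S (mu D)"
    unfolding max_min_value_def using R nonneg by (intro cInf_lower bdd_belowI[of _ 0]) auto
  then show "max_min_value k S p * gam_mu k S (mu D) \<le> lam k S D p"
    using D(2) by (simp add: pos_le_divide_eq)
qed

theorem theorem7p30:
  fixes n k t :: nat and pstar :: real and \<Psi> :: bcsp
  assumes "1 \<le> k" and "t \<le> k"
    and "pstar \<in> {0..1}"
    and "alpha k {t..k} = max_min_value k {t..k} pstar"
    and "bcsp_instance n k \<Psi>"
  shows "measure_pmf.expectation (rounding n k \<Psi> pstar) (csp_val k (threshold t k) \<Psi>)
           \<ge> alpha k {t..k} * csp_opt n k (threshold t k) \<Psi>"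
proof -
  let ?S = "{t..k}"
  obtain x where x: "csp_opt n k (symm_pred k ?S) \<Psi> = csp_val k (symm_pred k ?S) \<Psi> x"
    by (rule csp_opt_attained)
  have nonneg: "0 \<le> wgt C" if "C \<in># \<Psi>" for C
    using that assms(5) unfolding bcsp_instance_def by blast
  then have "0 \<le> (\<Sum>C\<in>#\<Psi>. wgt C)" 
    unfolding sum_mset_eq_sum_count by (intro sum_nonneg mult_nonneg_nonneg) auto
  then consider "(\<Sum>C\<in>#\<Psi>. wgt C) = 0" | "0 < (\<Sum>C\<in>#\<Psi>. wgt C)" by linarith
  then show ?thesis
  proof cases
    \<comment> \<open>With zero total weight both sides are 0 by the division convention.\<close>
    case 1
    then show ?thesis
      by (simp add: threshold_eq_symm_pred x rounding_expectation csp_val_eq_0)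
  next
    case 2
    obtain P where P: "set_pmf P \<subseteq> set_mset \<Psi>"
      "\<And>g. measure_pmf.expectation P g = (\<Sum>C\<in>#\<Psi>. wgt C * g C) / (\<Sum>C\<in>#\<Psi>. wgt C)"
      using weighted_pmf[of \<Psi> wgt, OF nonneg 2] by metis
    interpret constraint_pmf k n \<Psi> P by unfold_locales (use assms 2 P in auto)
    \<comment> \<open>\<open>DN\<close> comes from the greedy assignment and \<open>DY\<close> from
      an optimal one. Their means may differ, unlike in \<open>alpha\<close>; monotonicity of
      \<open>gam_mu\<close> bridges the gap.\<close>
    define DN where "DN = symmetrize k (pattern_dist (greedy n k \<Psi>))"
    define DY where "DY = symmetrize k (pattern_dist x)"
    have DN: "DN \<in> symm_dists k" and DY: "DY \<in> symm_dists k"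
      by (simp_all add: DN_def DY_def symmetrize_in_symm_dists)
    have "mu DY \<le> mu DN" unfolding DN_def DY_def by (rule mu_le_mu_greedy)
    then have le: "gam k ?S DY \<le> gam_mu k ?S (mu DN)"
      using assms(1,2) DY mu_le_1 by (intro gam_le_gam_mu)
    have "alpha k ?S * gam k ?S DY \<le> lam k ?S DN pstar"
    proof (cases "0 < gam_mu k ?S (mu DN)")
      case True
      note bounds = max_min_value_bounds[OF DN this, of pstar, folded assms(4)]
      show ?thesis using mult_left_mono[OF le bounds(1)] bounds(2) by linarith
    next
      \<comment> \<open>The ratio of \<open>DN\<close> is excluded from the infimum here, but
        \<open>le\<close> then forces \<open>gam\<close> of \<open>DY\<close> to be 0, and with it
        the left-hand side.\<close>
      case False
      have "0 \<le> gam k ?S DY" using symm_distsD[OF DY] by (simp add: gam_eq_pmf)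
      with False le have "gam k ?S DY = 0" by linarith
      then show ?thesis using lam_nonneg[OF symm_distsD[OF DN]] by simp
    qed
    then show ?thesis
      unfolding threshold_eq_symm_pred x rounding_expectation expectation_noisy_csp_val
      by (simp add: csp_val_eq_gam DN_def DY_def)
  qed
qed

end
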